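(* Let $n\ge1$ be a positive integer, let $R$ be an isometry in $\mathfrak{R}_n$ and let $\mathcal{M}=R\mathcal{H}_n$. The following are equivalent: (1) $R$ is a cyclic flip; (2) $\mu\, i(\mathcal{M})=\mathcal{M}$.
   Context: Let $\mathcal{F}_n$ be the unital free semigroup on $n$ generators $z_1,\dots,z_n$ (its unit is the empty word $1$), and let $\mathcal{H}_n=\ell_2(\mathcal{F}_n)$, with orthonormal basis $\{\xi_w: w\in\mathcal{F}_n\}$; $\xi_1$ is the basis vector of the empty word. Let $L_i$ and $R_i$ be the isometries on $\mathcal{H}_n$ with $L_i\xi_v=\xi_{z_iv}$ and $R_i\xi_v=\xi_{vz_i}$. $\mathfrak{L}_n$ (respectively $\mathfrak{R}_n$) is the unital algebra, closed in the weak operator topology, generated by $L_1,\dots,L_n$ (respectively $R_1,\dots,R_n$) in $\mathcal{B}(\mathcal{H}_n)$; each is the commutant of the other. For a closed $\mathfrak{L}_n$-invariant subspace $\mathcal{M}$ of $\mathcal{H}_n$, $i(\mathcal{M})=\{J\in\mathfrak{L}_n: J\xi_1\in\mathcal{M}\}$, which is a left ideal of $\mathfrak{L}_n$ closed in the weak operator topology. For such a left ideal $\mathcal{I}$, $\mu(\mathcal{I})=\overline{\mathcal{I}\xi_1}$ (norm closure of $\{J\xi_1:J\in\mathcal{I}\}$). An isometry $R\in\mathfrak{R}_n$ is a cyclic flip if there are operators (a net) $J_\alpha\in\mathfrak{L}_n$ such that $J_\alpha\xi_1\in R\mathcal{H}_n$ for all $\alpha$ and $R\xi_1=\lim_\alpha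 J_\alpha\xi_1$ in norm. *)

theory Defs
  imports "HOL-Analysis.Analysis"
begin

section \<open>The complex Hilbert space of square-summable families\<close>

lemma square_summable_add:
  fixes f g :: "'a \<Rightarrow> complex"
  assumes "(\<lambda>x. (cmod (f x))\<^sup>2) summable_on UNIV" "(\<lambda>x. (cmod (g x))\<^sup>2) summable_on UNIV"
  shows "(\<lambda>x. (cmod (f x + g x))\<^sup>2) summable_on UNIV"
proof (rule summable_on_comparison_test)
  show "(\<lambda>x. 2 * (cmod (f x))\<^sup>2 + 2 * (cmod (g x))\<^sup>2) summable_on UNIV"
    by (intro summable_on_add summable_on_cmult_right assms)
  fix x
  have "(cmod (f x + g x))\<^sup>2 \<le> (cmod (f x) + cmod (g x))\<^sup>2"
    by (intro power_mono norm_triangle_ineq) auto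
  also have "\<dots> \<le> 2 * (cmod (f x))\<^sup>2 + 2 * (cmod (g x))\<^sup>2"
    using sum_squares_bound[of "cmod (f x)" "cmod (g x)"] by (simp add: power2_sum)
  finally show "(cmod (f x + g x))\<^sup>2 \<le> 2 * (cmod (f x))\<^sup>2 + 2 * (cmod (g x))\<^sup>2" .
qed auto

lemma square_summable_scale:
  fixes f :: "'a \<Rightarrow> complex"
  assumes "(\<lambda>x. (cmod (f x))\<^sup>2) summable_on UNIV"
  shows "(\<lambda>x. (cmod (c * f x))\<^sup>2) summable_on UNIV"
  using summable_on_cmult_right[OF assms, of "(cmod c)\<^sup>2"]
  by (simp add: norm_mult power_mult_distrib)

lemma square_summable_prod:
  fixes f g :: "'a \<Rightarrow> complex"
  assumes "(\<lambda>x. (cmod (f x))\<^sup>2) summable_on UNIV" "(\<lambda>x. (cmod (g x))\<^sup>2) summable_on UNIV"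
  shows "(\<lambda>x. f x * cnj (g x)) summable_on UNIV"
proof (rule abs_summable_summable, rule summable_on_comparison_test)
  show "(\<lambda>x. (cmod (f x))\<^sup>2 + (cmod (g x))\<^sup>2) summable_on UNIV"
    by (intro summable_on_add assms)
  fix x
  have "0 \<le> cmod (f x) * cmod (g x)" by simp
  with sum_squares_bound[of "cmod (f x)" "cmod (g x)"]
  have "cmod (f x) * cmod (g x) \<le> (cmod (f x))\<^sup>2 + (cmod (g x))\<^sup>2" by linarith
  then show "cmod (f x * cnj (g x)) \<le> (cmod (f x))\<^sup>2 + (cmod (g x))\<^sup>2"
    by (simp add: norm_mult)
qed auto

typedef 'a ell2 = "{f :: 'a \<Rightarrow> complex. (\<lambda>x. (cmod (f x))\<^sup>2) summable_on UNIV}"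
  morphisms ell2_coord Abs_ell2
  by (rule exI[of _ "\<lambda>_. 0"]) simp

setup_lifting type_definition_ell2

lemma ell2_eqI: "(\<And>w. ell2_coord x w = ell2_coord y w) \<Longrightarrow> x = y"
  by (simp add: ell2_coord_inject[symmetric] fun_eq_iff)

lemma ell2_square_summable: "(\<lambda>w. (cmod (ell2_coord x w))\<^sup>2) summable_on UNIV"
  using ell2_coord[of x] by simp

lift_definition scaleC_ell2 :: "complex \<Rightarrow> 'a ell2 \<Rightarrow> 'a ell2" (infixr "*\<^sub>C" 75)
  is "\<lambda>c f w. c * f w"
  by (rule square_summable_scale)

lift_definition cinner_ell2 :: "'a ell2 \<Rightarrow> 'a ell2 \<Rightarrow> complex"
  is "\<lambda>f g. \<Sum>\<^sub>\<infinity>w. f w * cnj (g w)" .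

lift_definition ell2_basis :: "'a \<Rightarrow> 'a ell2"
  is "\<lambda>v w. if w = v then 1 else 0"
proof -
  fix v :: 'a
  have "(\<lambda>w. (cmod (if w = v then 1 else 0))\<^sup>2) summable_on {v}"
    by simp
  then show "(\<lambda>w. (cmod (if w = v then 1 else 0))\<^sup>2) summable_on UNIV"
    by (rule summable_on_cong_neutral[THEN iffD1, rotated -1]) auto
qed

text \<open>The underlying real inner product is the real part of \<^const>\<open>cinner_ell2\<close>; it induces the
  usual norm, so the topology and the real bounded operators come from the library.\<close>

instantiation ell2 :: (type) real_vector
begin

lift_definition zero_ell2 :: "'a ell2" is "\<lambda>_. 0" by simp
lift_definition plus_ell2 :: "'a ell2 \<Rightarrow> 'a ell2 \<Rightarrow> 'a ell2" is "\<lambda>f g w. f w + g w"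
  by (rule square_summable_add)
lift_definition uminus_ell2 :: "'a ell2 \<Rightarrow> 'a ell2" is "\<lambda>f w. - f w" by simp
lift_definition minus_ell2 :: "'a ell2 \<Rightarrow> 'a ell2 \<Rightarrow> 'a ell2" is "\<lambda>f g w. f w - g w"
  using square_summable_add[of _ "\<lambda>w. - g w" for g] by fastforce
definition "scaleR r x = complex_of_real r *\<^sub>C (x :: 'a ell2)"

instance
  by standard
    (auto intro!: ell2_eqI simp: plus_ell2.rep_eq zero_ell2.rep_eq uminus_ell2.rep_eq
      minus_ell2.rep_eq scaleR_ell2_def scaleC_ell2.rep_eq algebra_simps)

end

lemma ell2_prod_summable:
  "(\<lambda>w. ell2_coord x w * cnj (ell2_coord y w)) summable_on UNIV"
  by (intro square_summable_prod ell2_square_summable)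

lemma Re_cinner_ell2_self: "Re (cinner_ell2 x x) = (\<Sum>\<^sub>\<infinity>w. (cmod (ell2_coord x w))\<^sup>2)"
proof -
  have "Re (z * cnj z) = (cmod z)\<^sup>2" for z
    by (simp only: complex_mult_cnj Re_complex_of_real cmod_power2)
  then show ?thesis
    unfolding cinner_ell2.rep_eq by (simp only: infsum_Re[OF ell2_prod_summable, symmetric])
qed

instantiation ell2 :: (type) real_inner
begin

definition "inner x y = Re (cinner_ell2 x (y :: 'a ell2))"
definition "norm x = sqrt (inner x (x :: 'a ell2))"
definition "dist x y = norm (x - (y :: 'a ell2))"
definition "sgn x = inverse (norm x) *\<^sub>R (x :: 'a ell2)"
definition "uniformity = (INF e\<in>{0 <..}. principal {(x, y :: 'a ell2). dist x y < e})"
definition "open (U :: 'a ell2 set)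
  \<longleftrightarrow> (\<forall>x\<in>U. eventually (\<lambda>(x', y). x' = x \<longrightarrow> y \<in> U) uniformity)"

instance
proof
  fix x y z :: "'a ell2" and r s :: real and U :: "'a ell2 set"
  show "dist x y = norm (x - y)" "sgn x = x /\<^sub>R norm x" "norm x = sqrt (inner x x)"
    by (rule dist_ell2_def sgn_ell2_def norm_ell2_def)+
  show "uniformity = (INF e\<in>{0 <..}. principal {(x, y :: 'a ell2). dist x y < e})"
    by (rule uniformity_ell2_def)
  show "open U \<longleftrightarrow> (\<forall>x\<in>U. eventually (\<lambda>(x', y). x' = x \<longrightarrow> y \<in> U) uniformity)"
    by (rule open_ell2_def)
  have "cinner_ell2 y x = cnj (cinner_ell2 x y)"
    by (simp add: cinner_ell2.rep_eq infsum_cnj[symmetric] mult.commute)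
  then show "inner x y = inner y x"
    unfolding inner_ell2_def by simp
  show "inner (x + y) z = inner x z + inner y z"
    unfolding inner_ell2_def cinner_ell2.rep_eq plus_ell2.rep_eq
    by (simp add: ring_distribs infsum_add ell2_prod_summable)
  show "inner (r *\<^sub>R x) y = r * inner x y"
    unfolding inner_ell2_def cinner_ell2.rep_eq scaleR_ell2_def scaleC_ell2.rep_eq
    by (simp add: mult.assoc infsum_cmult_right')
  have sq: "inner x x = (\<Sum>\<^sub>\<infinity>w. (cmod (ell2_coord x w))\<^sup>2)"
    unfolding inner_ell2_def by (rule Re_cinner_ell2_self)
  show "0 \<le> inner x x"
    unfolding sq by (intro infsum_nonneg) auto
  show "inner x x = 0 \<longleftrightarrow> x = 0"
  proof
    assume "inner x x = 0"
    then have "(cmod (ell2_coord x w))\<^sup>2 = 0" for w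
      using nonneg_infsum_le_0D[of "\<lambda>w. (cmod (ell2_coord x w))\<^sup>2" UNIV w]
        ell2_square_summable[of x] unfolding sq by auto
    then show "x = 0"
      by (intro ell2_eqI) (simp add: zero_ell2.rep_eq)
  next
    assume "x = 0"
    then show "inner x x = 0"
      unfolding sq by (simp add: zero_ell2.rep_eq)
  qed
qed

end

lemma norm_ell2_power2: "(norm x)\<^sup>2 = (\<Sum>\<^sub>\<infinity>w. (cmod (ell2_coord x w))\<^sup>2)"
  by (simp only: Re_cinner_ell2_self[symmetric] inner_ell2_def[symmetric] dot_square_norm)

lemma ell2_finite_sum_le:
  assumes "finite F"
  shows "(\<Sum>w\<in>F. (cmod (ell2_coord x w))\<^sup>2) \<le> (norm x)\<^sup>2"
  unfolding norm_ell2_power2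
  by (intro finite_sum_le_infsum ell2_square_summable assms) auto

instance ell2 :: (type) banach
proof
  fix X :: "nat \<Rightarrow> 'a ell2"
  assume X: "Cauchy X"
  let ?c = "\<lambda>n w. ell2_coord (X n) w"
  have coord: "cmod (?c m w - ?c n w) \<le> norm (X m - X n)" for m n w
    using ell2_finite_sum_le[of "{w}" "X m - X n"]
    by (simp add: minus_ell2.rep_eq abs_le_square_iff[symmetric])
  have "Cauchy (\<lambda>n. ?c n w)" for w
    unfolding Cauchy_def dist_norm
  proof (intro allI impI)
    fix e :: real
    assume "e > 0"
    then obtain N where "\<forall>m\<ge>N. \<forall>n\<ge>N. norm (X m - X n) < e"
      using X unfolding Cauchy_def dist_norm by blast
    then show "\<exists>N. \<forall>m\<ge>N. \<forall>n\<ge>N. cmod (?c m w - ?c n w) < e"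
      using coord le_less_trans by blast
  qed
  then have lim: "(\<lambda>n. ?c n w) \<longlonglongrightarrow> lim (\<lambda>n. ?c n w)" for w
    by (simp add: Cauchy_convergent_iff convergent_LIMSEQ_iff)
  define g where "g w = lim (\<lambda>n. ?c n w)" for w
  have g: "(\<lambda>n. ?c n w) \<longlonglongrightarrow> g w" for w
    unfolding g_def by (rule lim)
  have tail: "(\<Sum>w\<in>F. (cmod (?c m w - g w))\<^sup>2) \<le> e\<^sup>2"
    if N: "\<And>n. n \<ge> N \<Longrightarrow> norm (X m - X n) < e" and F: "finite F" for e m N F
  proof (rule tendsto_upperbound)
    show "(\<lambda>n. \<Sum>w\<in>F. (cmod (?c m w - ?c n w))\<^sup>2) \<longlonglongrightarrow> (\<Sum>w\<in>F. (cmod (?c m w - g w))\<^sup>2)"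
      by (intro tendsto_intros g)
    have "(\<Sum>w\<in>F. (cmod (?c m w - ?c n w))\<^sup>2) \<le> e\<^sup>2" if "n \<ge> N" for n
    proof -
      have "(\<Sum>w\<in>F. (cmod (?c m w - ?c n w))\<^sup>2) \<le> (norm (X m - X n))\<^sup>2"
        using ell2_finite_sum_le[OF F, of "X m - X n"] by (simp add: minus_ell2.rep_eq)
      also have "\<dots> \<le> e\<^sup>2"
        using N[OF that] by (intro power_mono) auto
      finally show ?thesis .
    qed
    then show "\<forall>\<^sub>F n in sequentially. (\<Sum>w\<in>F. (cmod (?c m w - ?c n w))\<^sup>2) \<le> e\<^sup>2"
      by (auto simp: eventually_sequentially)
  qed simp
  have summable: "(\<lambda>w. (cmod (?c m w - g w))\<^sup>2) summable_on UNIV"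
    if "\<And>n. n \<ge> N \<Longrightarrow> norm (X m - X n) < e" for e m N
    by (rule nonneg_bdd_above_summable_on)
      (auto intro!: bdd_aboveI[of _ "e\<^sup>2"] tail that)
  obtain N where N: "\<And>m n. m \<ge> N \<Longrightarrow> n \<ge> N \<Longrightarrow> norm (X m - X n) < 1"
    using X unfolding Cauchy_def dist_norm using zero_less_one by blast
  have "(\<lambda>w. (cmod (?c N w + (-1) * (?c N w - g w)))\<^sup>2) summable_on UNIV"
    by (intro square_summable_add square_summable_scale ell2_square_summable summable[of N N 1] N)
      simp_all
  then have "(\<lambda>w. (cmod (g w))\<^sup>2) summable_on UNIV"
    by simp
  then have G: "ell2_coord (Abs_ell2 g) = g"
    by (simp add: Abs_ell2_inverse)
  have "X \<longlonglongrightarrow> Abs_ell2 g"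
  proof (rule metric_LIMSEQ_I)
    fix r :: real
    assume "r > 0"
    then have "r / 2 > 0"
      by simp
    then obtain N where N: "\<And>m n. m \<ge> N \<Longrightarrow> n \<ge> N \<Longrightarrow> norm (X m - X n) < r / 2"
      using X unfolding Cauchy_def dist_norm by blast
    have "dist (X m) (Abs_ell2 g) < r" if "m \<ge> N" for m
    proof -
      have "(norm (X m - Abs_ell2 g))\<^sup>2 \<le> (r / 2)\<^sup>2"
        unfolding norm_ell2_power2 minus_ell2.rep_eq G
        by (intro infsum_le_finite_sums summable[of N m "r / 2"] tail[of N m "r / 2"] N that)
      then show ?thesis
        using \<open>r > 0\<close> by (simp add: dist_norm abs_le_square_iff[symmetric])
    qed
    then show "\<exists>N. \<forall>m\<ge>N. dist (X m) (Abs_ell2 g) < r"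
      by blast
  qed
  then show "convergent X"
    by (auto simp: convergent_def)
qed

section \<open>Bounded operators and the weak operator topology\<close>

text \<open>Elements of \<^typ>\<open>'a ell2 \<Rightarrow>\<^sub>L 'a ell2\<close> are only real-linear; the bounded operators of the
  complex Hilbert space are those satisfying the predicate below.\<close>

definition complex_linear :: "('a ell2 \<Rightarrow>\<^sub>L 'a ell2) \<Rightarrow> bool" where
  "complex_linear T \<longleftrightarrow> (\<forall>c x. blinfun_apply T (c *\<^sub>C x) = c *\<^sub>C blinfun_apply T x)"

text \<open>\<^const>\<open>euclidean\<close> below is the product topology on functions from pairs of vectors to the
  complex numbers, so this is the coarsest topology making all \<open>T \<mapsto> \<langle>T x, y\<rangle>\<close> continuous.\<close>

definition weak_operator_topology :: "('a ell2 \<Rightarrow>\<^sub>L 'a ell2) topology" where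
  "weak_operator_topology = pullback_topology {T. complex_linear T}
     (\<lambda>T (x, y). cinner_ell2 (blinfun_apply T x) y) euclidean"

lift_definition scaleC_op :: "complex \<Rightarrow> 'a ell2 \<Rightarrow>\<^sub>L 'a ell2" is "\<lambda>c x. c *\<^sub>C x"
proof -
  fix c :: complex
  have sq: "(norm (c *\<^sub>C x))\<^sup>2 = (cmod c * norm x)\<^sup>2" for x :: "'a ell2"
    by (simp add: norm_ell2_power2 scaleC_ell2.rep_eq norm_mult power_mult_distrib
        infsum_cmult_right')
  have "norm (c *\<^sub>C x) \<le> norm x * cmod c" for x :: "'a ell2"
    using sq[of x] by (simp add: power2_eq_iff_nonneg mult.commute)
  then show "bounded_linear (\<lambda>x :: 'a ell2. c *\<^sub>C x)"
    by (intro bounded_linear_intro[where K = "cmod c"] ell2_eqI)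
      (simp_all add: scaleC_ell2.rep_eq plus_ell2.rep_eq scaleR_ell2_def algebra_simps)
qed

definition unital_subalgebra :: "('a ell2 \<Rightarrow>\<^sub>L 'a ell2) set \<Rightarrow> bool" where
  "unital_subalgebra A \<longleftrightarrow>
     A \<subseteq> {T. complex_linear T} \<and> id_blinfun \<in> A \<and>
     (\<forall>S\<in>A. \<forall>T\<in>A. S + T \<in> A \<and> S o\<^sub>L T \<in> A) \<and>
     (\<forall>c. \<forall>T\<in>A. scaleC_op c o\<^sub>L T \<in> A)"

definition wot_algebra_generated :: "('a ell2 \<Rightarrow>\<^sub>L 'a ell2) set \<Rightarrow> ('a ell2 \<Rightarrow>\<^sub>L 'a ell2) set" where
  "wot_algebra_generated G =
     (\<lambda>A. unital_subalgebra A \<and> closedin weak_operator_topology A) hull G"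

definition isometric :: "('a ell2 \<Rightarrow>\<^sub>L 'a ell2) \<Rightarrow> bool" where
  "isometric T \<longleftrightarrow> (\<forall>x. norm (blinfun_apply T x) = norm x)"

section \<open>The free semigroup algebras\<close>

text \<open>Words in the generators are lists over the finite type \<^typ>\<open>'n\<close> with \<open>n = CARD('n)\<close> elements
  (so \<open>n \<ge> 1\<close>), with the empty list as unit.\<close>

type_synonym 'n fock = "'n list ell2"
type_synonym 'n fock_op = "'n list ell2 \<Rightarrow>\<^sub>L 'n list ell2"

abbreviation vacuum :: "'n fock" ("\<xi>\<^sub>1") where "\<xi>\<^sub>1 \<equiv> ell2_basis []"

lemma pushforward_square_summable:
  fixes f :: "'a \<Rightarrow> complex"
  assumes f: "(\<lambda>x. (cmod (f x))\<^sup>2) summable_on UNIV" and p: "inj p"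
    and h: "\<And>v. h (p v) = f v" "\<And>w. w \<notin> range p \<Longrightarrow> h w = 0"
  shows "(\<lambda>w. (cmod (h w))\<^sup>2) summable_on UNIV"
    and "(\<Sum>\<^sub>\<infinity>w. (cmod (h w))\<^sup>2) = (\<Sum>\<^sub>\<infinity>v. (cmod (f v))\<^sup>2)"
proof -
  have "(\<lambda>w. (cmod (h w))\<^sup>2) summable_on range p"
    using f by (subst summable_on_reindex[OF p]) (simp add: o_def h)
  then show "(\<lambda>w. (cmod (h w))\<^sup>2) summable_on UNIV"
    by (rule summable_on_cong_neutral[THEN iffD1, rotated -1]) (auto simp: h)
  have "(\<Sum>\<^sub>\<infinity>w. (cmod (h w))\<^sup>2) = (\<Sum>\<^sub>\<infinity>w\<in>range p. (cmod (h w))\<^sup>2)"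
    by (rule infsum_cong_neutral) (auto simp: h)
  also have "\<dots> = (\<Sum>\<^sub>\<infinity>v. (cmod (f v))\<^sup>2)"
    by (subst infsum_reindex[OF p]) (simp add: o_def h)
  finally show "(\<Sum>\<^sub>\<infinity>w. (cmod (h w))\<^sup>2) = (\<Sum>\<^sub>\<infinity>v. (cmod (f v))\<^sup>2)" .
qed

lemma left_shift_square_summable:
  fixes i :: 'n and f :: "'n list \<Rightarrow> complex"
  defines "h \<equiv> \<lambda>w. if w \<noteq> [] \<and> hd w = i then f (tl w) else 0"
  assumes f: "(\<lambda>x. (cmod (f x))\<^sup>2) summable_on UNIV"
  shows "(\<lambda>w. (cmod (h w))\<^sup>2) summable_on UNIV"
    and "(\<Sum>\<^sub>\<infinity>w. (cmod (h w))\<^sup>2) = (\<Sum>\<^sub>\<infinity>v. (cmod (f v))\<^sup>2)"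
proof -
  have p: "inj (Cons i)" and h: "\<And>v. h (i # v) = f v"
    by (simp_all add: h_def)
  have z: "h w = 0" if "w \<notin> range (Cons i)" for w
    using that by (cases w) (auto simp: h_def)
  show "(\<lambda>w. (cmod (h w))\<^sup>2) summable_on UNIV"
    by (rule pushforward_square_summable(1)[OF f p h z])
  show "(\<Sum>\<^sub>\<infinity>w. (cmod (h w))\<^sup>2) = (\<Sum>\<^sub>\<infinity>v. (cmod (f v))\<^sup>2)"
    by (rule pushforward_square_summable(2)[OF f p h z])
qed

lemma right_shift_square_summable:
  fixes i :: 'n and f :: "'n list \<Rightarrow> complex"
  defines "h \<equiv> \<lambda>w. if w \<noteq> [] \<and> last w = i then f (butlast w) else 0"
  assumes f: "(\<lambda>x. (cmod (f x))\<^sup>2) summable_on UNIV"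
  shows "(\<lambda>w. (cmod (h w))\<^sup>2) summable_on UNIV"
    and "(\<Sum>\<^sub>\<infinity>w. (cmod (h w))\<^sup>2) = (\<Sum>\<^sub>\<infinity>v. (cmod (f v))\<^sup>2)"
proof -
  have p: "inj (\<lambda>v. v @ [i])" and h: "\<And>v. h (v @ [i]) = f v"
    by (simp_all add: h_def inj_def)
  have z: "h w = 0" if "w \<notin> range (\<lambda>v. v @ [i])" for w
    using that by (cases w rule: rev_cases) (auto simp: h_def)
  show "(\<lambda>w. (cmod (h w))\<^sup>2) summable_on UNIV"
    by (rule pushforward_square_summable(1)[OF f p h z])
  show "(\<Sum>\<^sub>\<infinity>w. (cmod (h w))\<^sup>2) = (\<Sum>\<^sub>\<infinity>v. (cmod (f v))\<^sup>2)"
    by (rule pushforward_square_summable(2)[OF f p h z])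
qed

lift_definition left_shift_fun :: "'n \<Rightarrow> 'n fock \<Rightarrow> 'n fock"
  is "\<lambda>i f w. if w \<noteq> [] \<and> hd w = i then f (tl w) else 0"
  by (rule left_shift_square_summable(1))

lift_definition right_shift_fun :: "'n \<Rightarrow> 'n fock \<Rightarrow> 'n fock"
  is "\<lambda>i f w. if w \<noteq> [] \<and> last w = i then f (butlast w) else 0"
  by (rule right_shift_square_summable(1))

lemma norm_left_shift_fun: "norm (left_shift_fun i x) = norm x"
proof -
  have "(norm (left_shift_fun i x))\<^sup>2 = (norm x)\<^sup>2"
    unfolding norm_ell2_power2 left_shift_fun.rep_eq
    by (rule left_shift_square_summable(2)[OF ell2_square_summable])
  then show ?thesis
    by (simp add: power2_eq_iff_nonneg)
qed

lemma norm_right_shift_fun: "norm (right_shift_fun i x) = norm x"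
proof -
  have "(norm (right_shift_fun i x))\<^sup>2 = (norm x)\<^sup>2"
    unfolding norm_ell2_power2 right_shift_fun.rep_eq
    by (rule right_shift_square_summable(2)[OF ell2_square_summable])
  then show ?thesis
    by (simp add: power2_eq_iff_nonneg)
qed

lift_definition left_creation :: "'n \<Rightarrow> 'n fock_op" is left_shift_fun
  by (intro bounded_linear_intro[where K = 1] ell2_eqI)
    (simp_all add: norm_left_shift_fun left_shift_fun.rep_eq plus_ell2.rep_eq
      scaleR_ell2_def scaleC_ell2.rep_eq)

lift_definition right_creation :: "'n \<Rightarrow> 'n fock_op" is right_shift_fun
  by (intro bounded_linear_intro[where K = 1] ell2_eqI)
    (simp_all add: norm_right_shift_fun right_shift_fun.rep_eq plus_ell2.rep_eq
      scaleR_ell2_def scaleC_ell2.rep_eq)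

lemma left_creation_basis:
  "blinfun_apply (left_creation i) (ell2_basis v) = ell2_basis (i # v)"
  by (rule ell2_eqI)
    (auto simp: left_creation.rep_eq left_shift_fun.rep_eq ell2_basis.rep_eq)

lemma right_creation_basis:
  "blinfun_apply (right_creation i) (ell2_basis v) = ell2_basis (v @ [i])"
  by (rule ell2_eqI)
    (auto simp: right_creation.rep_eq right_shift_fun.rep_eq ell2_basis.rep_eq)

definition left_algebra :: "('n::finite) fock_op set" where
  "left_algebra = wot_algebra_generated (range left_creation)"

definition right_algebra :: "('n::finite) fock_op set" where
  "right_algebra = wot_algebra_generated (range right_creation)"

definition ideal_of_subspace :: "('n::finite) fock set \<Rightarrow> 'n fock_op set" where
  "ideal_of_subspace M = {J \<in> left_algebra. blinfun_apply J \<xi>\<^sub>1 \<in> M}"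

definition subspace_of_ideal :: "('n::finite) fock_op set \<Rightarrow> 'n fock set" where
  "subspace_of_ideal I = closure ((\<lambda>J. blinfun_apply J \<xi>\<^sub>1) ` I)"

text \<open>A net of operators is represented by its filter of tails: every net \<open>J\<^sub>\<alpha>\<close> induces a proper
  filter on the operators, and every proper filter arises from a net in this way, which may be
  taken inside any given set that belongs to the filter.\<close>

definition cyclic_flip :: "('n::finite) fock_op \<Rightarrow> bool" where
  "cyclic_flip R \<longleftrightarrow> R \<in> right_algebra \<and> isometric R \<and>
     (\<exists>F :: 'n fock_op filter. F \<noteq> bot \<and>
        (\<forall>\<^sub>F J in F. J \<in> left_algebra \<and> blinfun_apply J \<xi>\<^sub>1 \<in> range (blinfun_apply R)) \<and>
        ((\<lambda>J. blinfun_apply J \<xi>\<^sub>1) \<longlongrightarrow> blinfun_apply R \<xi>\<^sub>1) F)"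

end

theory Submission
  imports Defs
begin

text \<open>
  Everything rests on one fact: an operator \<open>R\<close> of the right algebra commutes with every left
  creation operator (\<open>right_algebra_commutes_left_creation\<close>).  The commutant of the left creation
  operators is a unital algebra containing the right creation operators, and it is closed in the
  weak operator topology because commuting with a shift can be expressed by equations between
  coordinates of \<open>T x\<close>, which depend continuously on \<open>T\<close>.

  Write \<open>M\<close> for the range of \<open>R\<close> and \<open>N\<close> for the closure of \<open>{J \<xi>\<^sub>1}\<close>, where \<open>J\<close> ranges over the left
  ideal attached to \<open>M\<close>.  Always \<open>N \<subseteq> M\<close>, since the range of an isometry is closed.  A cyclic flip is
  by definition an isometry \<open>R\<close> with \<open>R \<xi>\<^sub>1 \<in> N\<close> (\<open>cyclic_flip_iff_vacuum_image\<close>): a net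
  converging to a point with values in a set is the same thing as membership in the closure.  So
  \<open>N = M\<close> trivially gives a cyclic flip.  Conversely \<open>N\<close> is a closed complex subspace, and it is
  invariant under the left creation operators because \<open>M\<close> is.  If it contains \<open>R \<xi>\<^sub>1\<close>, it contains
  \<open>L\<^sub>w R \<xi>\<^sub>1 = R L\<^sub>w \<xi>\<^sub>1 = R \<xi>\<^sub>w\<close> for every word \<open>w\<close>, hence \<open>R x\<close> for all \<open>x\<close>, as the basis vectors
  \<open>\<xi>\<^sub>w\<close> span a dense subspace.
\<close>

section \<open>Coordinates and density of finitely supported vectors\<close>

lemma ell2_coord_sum: "ell2_coord (\<Sum>a\<in>A. f a) w = (\<Sum>a\<in>A. ell2_coord (f a) w)"
  by (induction A rule: infinite_finite_induct) (auto simp: zero_ell2.rep_eq plus_ell2.rep_eq)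

lemma cinner_ell2_basis: "cinner_ell2 x (ell2_basis w) = ell2_coord x w"
proof -
  have "cinner_ell2 x (ell2_basis w) = (\<Sum>\<^sub>\<infinity>v\<in>{w}. ell2_coord x v)"
    unfolding cinner_ell2.rep_eq ell2_basis.rep_eq by (rule infsum_cong_neutral) auto
  then show ?thesis by simp
qed

lemma ell2_coord_truncation:
  assumes "finite F"
  shows "ell2_coord (\<Sum>v\<in>F. ell2_coord x v *\<^sub>C ell2_basis v) w = (if w \<in> F then ell2_coord x w else 0)"
proof -
  have "ell2_coord (\<Sum>v\<in>F. ell2_coord x v *\<^sub>C ell2_basis v) w
      = (\<Sum>v\<in>F. if w = v then ell2_coord x v else 0)"
    by (simp add: ell2_coord_sum scaleC_ell2.rep_eq ell2_basis.rep_eq if_distrib cong: if_cong)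
  then show ?thesis using assms by simp
qed

text \<open>The squared distance from \<open>x\<close> to its truncation to a finite set \<open>F\<close> is the tail of the
  convergent sum of the \<open>(cmod (ell2_coord x w))\<^sup>2\<close> outside \<open>F\<close>.\<close>

lemma closed_subspace_contains_all:
  fixes V :: "'a ell2 set"
  assumes "subspace V" and "closed V"
    and scaleC: "\<And>c x. x \<in> V \<Longrightarrow> c *\<^sub>C x \<in> V"
    and basis: "\<And>w. ell2_basis w \<in> V"
  shows "x \<in> V"
proof -
  let ?t = "\<lambda>F. \<Sum>v\<in>F. ell2_coord x v *\<^sub>C ell2_basis v"
  let ?q = "\<lambda>w. (cmod (ell2_coord x w))\<^sup>2"
  have tail: "(norm (?t F - x))\<^sup>2 = infsum ?q UNIV - sum ?q F" if F: "finite F" for F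
  proof -
    have "(norm (?t F - x))\<^sup>2 = (\<Sum>\<^sub>\<infinity>w. (cmod ((if w \<in> F then ell2_coord x w else 0) - ell2_coord x w))\<^sup>2)"
      unfolding norm_ell2_power2 minus_ell2.rep_eq ell2_coord_truncation[OF F] ..
    also have "\<dots> = infsum ?q (UNIV - F)"
      by (rule infsum_cong_neutral) auto
    also have "\<dots> = infsum ?q UNIV - infsum ?q F"
      by (rule infsum_Diff) (use F in \<open>auto intro: ell2_square_summable\<close>)
    finally show ?thesis using F by simp
  qed
  have "((\<lambda>F. sum ?q F) \<longlongrightarrow> infsum ?q UNIV) (finite_subsets_at_top UNIV)"
    using ell2_square_summable[of x] by (rule infsum_tendsto)
  then have "((\<lambda>F. sqrt (infsum ?q UNIV - sum ?q F)) \<longlongrightarrow> sqrt (infsum ?q UNIV - infsum ?q UNIV))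
      (finite_subsets_at_top UNIV)"
    by (intro tendsto_intros)
  then have "((\<lambda>F. sqrt (infsum ?q UNIV - sum ?q F)) \<longlongrightarrow> 0) (finite_subsets_at_top UNIV)"
    by simp
  then have "((\<lambda>F. norm (?t F - x)) \<longlongrightarrow> 0) (finite_subsets_at_top UNIV)"
    by (rule Lim_transform_eventually)
      (auto intro!: eventually_finite_subsets_at_top_weakI simp: tail[symmetric])
  then have "((\<lambda>F. ?t F) \<longlongrightarrow> x) (finite_subsets_at_top UNIV)"
    by (subst (asm) tendsto_norm_zero_iff) (simp add: LIM_zero_iff)
  moreover have "?t F \<in> V" for F
    by (intro subspace_sum[OF \<open>subspace V\<close>] scaleC basis)
  ultimately show ?thesis
    using \<open>closed V\<close> by (intro Lim_in_closed_set[of V ?t]) auto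
qed

section \<open>The right algebra commutes with the left creation operators\<close>

definition left_creation_commutant :: "('n::finite) fock_op set" where
  "left_creation_commutant =
     {T. complex_linear T \<and> (\<forall>i. T o\<^sub>L left_creation i = left_creation i o\<^sub>L T)}"

lemma complex_linear_right_creation: "complex_linear (right_creation i)"
  unfolding complex_linear_def
  by (auto intro!: ell2_eqI simp: right_creation.rep_eq right_shift_fun.rep_eq scaleC_ell2.rep_eq)

lemma right_creation_in_commutant: "right_creation j \<in> left_creation_commutant"
proof -
  have "blinfun_apply (right_creation j) (blinfun_apply (left_creation i) x)
      = blinfun_apply (left_creation i) (blinfun_apply (right_creation j) x)" for i and x :: "'a fock"
  proof (rule ell2_eqI)
    fix w
    show "ell2_coord (blinfun_apply (right_creation j) (blinfun_apply (left_creation i) x)) w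
        = ell2_coord (blinfun_apply (left_creation i) (blinfun_apply (right_creation j) x)) w"
      \<comment> \<open>Deleting the first and the last letter of a word are commuting operations, with a one-letter
        word as the degenerate case: there both sides vanish.\<close>
      by (cases w; cases "tl w" rule: rev_cases)
        (auto simp: left_creation.rep_eq right_creation.rep_eq left_shift_fun.rep_eq
          right_shift_fun.rep_eq)
  qed
  then show ?thesis
    unfolding left_creation_commutant_def
    by (auto intro!: blinfun_eqI simp: complex_linear_right_creation)
qed

lemma scaleC_ell2_add: "c *\<^sub>C (x + y) = c *\<^sub>C x + c *\<^sub>C y"
  by (rule ell2_eqI) (simp add: scaleC_ell2.rep_eq plus_ell2.rep_eq algebra_simps)

lemma scaleC_ell2_left_commute: "c *\<^sub>C d *\<^sub>C x = d *\<^sub>C c *\<^sub>C x"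
  by (rule ell2_eqI) (simp add: scaleC_ell2.rep_eq)

lemma left_creation_scaleC:
  "blinfun_apply (left_creation i) (c *\<^sub>C x) = c *\<^sub>C blinfun_apply (left_creation i) x"
  by (auto intro!: ell2_eqI simp: left_creation.rep_eq left_shift_fun.rep_eq scaleC_ell2.rep_eq)

lemma left_creation_commutant_iff:
  "T \<in> left_creation_commutant \<longleftrightarrow> complex_linear T \<and>
     (\<forall>i x. blinfun_apply T (blinfun_apply (left_creation i) x)
        = blinfun_apply (left_creation i) (blinfun_apply T x))"
  unfolding left_creation_commutant_def by (auto simp: blinfun_apply_inject[symmetric] fun_eq_iff)

lemma unital_subalgebra_commutant: "unital_subalgebra left_creation_commutant"
  unfolding unital_subalgebra_def
  by (auto simp: left_creation_commutant_iff complex_linear_def blinfun.add_left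
      blinfun.add_right scaleC_op.rep_eq scaleC_ell2_add left_creation_scaleC
      intro: scaleC_ell2_left_commute)

lemma topspace_weak_operator_topology [simp]:
  "topspace weak_operator_topology = {T. complex_linear T}"
  by (simp add: weak_operator_topology_def topspace_pullback_topology)

lemma continuous_map_matrix_coefficient:
  "continuous_map weak_operator_topology euclidean (\<lambda>T. cinner_ell2 (blinfun_apply T x) y)"
proof -
  have "continuous_map euclidean euclidean (\<lambda>h :: 'a ell2 \<times> 'a ell2 \<Rightarrow> complex. h (x, y))"
    by simp
  from continuous_map_pullback[OF this, of "{T. complex_linear T}"
      "\<lambda>T (x, y). cinner_ell2 (blinfun_apply T x) y"]
  show ?thesis
    by (simp add: weak_operator_topology_def o_def)
qed

lemma continuous_map_coord:
  "continuous_map weak_operator_topology euclidean (\<lambda>T. ell2_coord (blinfun_apply T x) w)"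
  using continuous_map_matrix_coefficient[of x "ell2_basis w"] by (simp add: cinner_ell2_basis)

text \<open>Written in coordinates, the commutation relation says that coordinate \<open>w\<close> of \<open>T L\<^sub>i x\<close> is
  either zero or coordinate \<open>tl w\<close> of \<open>T x\<close>, so the commutant is an intersection of zero sets of
  weakly continuous functions of \<open>T\<close>.\<close>

lemma closedin_commutant: "closedin weak_operator_topology left_creation_commutant"
proof -
  define d :: "'a \<times> 'a fock \<times> 'a list \<Rightarrow> 'a fock_op \<Rightarrow> complex" where
    "d = (\<lambda>(i, x, w) T. ell2_coord (blinfun_apply T (blinfun_apply (left_creation i) x)) w
      - (if w \<noteq> [] \<and> hd w = i then ell2_coord (blinfun_apply T x) (tl w) else 0))"
  have "continuous_map weak_operator_topology euclidean (d p)" for p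
    unfolding d_def
    by (cases p; cases "snd (snd p) \<noteq> [] \<and> hd (snd (snd p)) = fst p")
      (auto intro!: continuous_map_diff continuous_map_coord)
  then have "closedin weak_operator_topology {T \<in> topspace weak_operator_topology. d p T \<in> {0}}" for p
    by (rule closedin_continuous_map_preimage) simp
  then have "closedin weak_operator_topology
      (\<Inter>p. {T \<in> topspace weak_operator_topology. d p T \<in> {0}})"
    by (intro closedin_Inter) auto
  moreover have "(\<Inter>p. {T \<in> topspace weak_operator_topology. d p T \<in> {0}}) = left_creation_commutant"
    by (auto simp: left_creation_commutant_iff d_def left_creation.rep_eq left_shift_fun.rep_eq
        ell2_coord_inject[symmetric] fun_eq_iff)
  ultimately show ?thesis by simp
qed

lemma right_algebra_subset_commutant: "right_algebra \<subseteq> left_creation_commutant"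
  unfolding right_algebra_def wot_algebra_generated_def
  by (rule hull_minimal)
    (auto intro: right_creation_in_commutant unital_subalgebra_commutant closedin_commutant)

lemma right_algebra_complex_linear:
  assumes "R \<in> right_algebra"
  shows "blinfun_apply R (c *\<^sub>C x) = c *\<^sub>C blinfun_apply R x"
  using assms right_algebra_subset_commutant
  by (auto simp: left_creation_commutant_iff complex_linear_def)

lemma right_algebra_commutes_left_creation:
  assumes "R \<in> right_algebra"
  shows "blinfun_apply R (blinfun_apply (left_creation i) x)
    = blinfun_apply (left_creation i) (blinfun_apply R x)"
  using assms right_algebra_subset_commutant by (auto simp: left_creation_commutant_iff)

section \<open>The subspace generated by the ideal of an invariant subspace\<close>

lemma subspace_closure:
  fixes S :: "'a::real_normed_vector set"
  assumes S: "subspace S"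
  shows "subspace (closure S)"
proof (rule subspaceI)
  show "0 \<in> closure S"
    using subspace_0[OF S] closure_subset by blast
next
  fix x y
  assume "x \<in> closure S" "y \<in> closure S"
  then obtain f g where "\<forall>k. f k \<in> S" "f \<longlonglongrightarrow> x" "\<forall>k. g k \<in> S" "g \<longlonglongrightarrow> y"
    unfolding closure_sequential by blast
  then have "\<forall>k. f k + g k \<in> S" "(\<lambda>k. f k + g k) \<longlonglongrightarrow> x + y"
    by (auto intro: tendsto_add subspace_add[OF S])
  then show "x + y \<in> closure S"
    unfolding closure_sequential by (intro exI conjI)
next
  fix r :: real and x
  assume "x \<in> closure S"
  moreover have "(*\<^sub>R) r ` closure S \<subseteq> closure S"
    using closure_scaleR[of r S] closure_mono[of "(*\<^sub>R) r ` S" S] subspace_scale[OF S] by blast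
  ultimately show "r *\<^sub>R x \<in> closure S"
    by blast
qed

lemma left_algebra_closure_properties:
  shows "left_creation i \<in> left_algebra"
    and "id_blinfun \<in> left_algebra"
    and "S \<in> left_algebra \<Longrightarrow> T \<in> left_algebra \<Longrightarrow> S + T \<in> left_algebra"
    and "S \<in> left_algebra \<Longrightarrow> T \<in> left_algebra \<Longrightarrow> S o\<^sub>L T \<in> left_algebra"
    and "T \<in> left_algebra \<Longrightarrow> scaleC_op c o\<^sub>L T \<in> left_algebra"
  unfolding left_algebra_def wot_algebra_generated_def hull_def unital_subalgebra_def
  by auto

lemma scaleR_eq_scaleC_op: "r *\<^sub>R T = scaleC_op (complex_of_real r) o\<^sub>L T"
  by (rule blinfun_eqI) (simp add: scaleC_op.rep_eq blinfun.scaleR_left scaleR_ell2_def)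

locale left_invariant_subspace =
  fixes M :: "('n::finite) fock set"
  assumes subspace: "subspace M"
    and scaleC: "x \<in> M \<Longrightarrow> c *\<^sub>C x \<in> M"
    and left_creation: "x \<in> M \<Longrightarrow> blinfun_apply (left_creation i) x \<in> M"
begin

lemma scaleC_ideal:
  assumes "J \<in> ideal_of_subspace M"
  shows "scaleC_op c o\<^sub>L J \<in> ideal_of_subspace M"
  using assms by (auto simp: ideal_of_subspace_def scaleC_op.rep_eq scaleC
      intro: left_algebra_closure_properties)

lemma left_creation_ideal:
  assumes "J \<in> ideal_of_subspace M"
  shows "left_creation i o\<^sub>L J \<in> ideal_of_subspace M"
  using assms by (auto simp: ideal_of_subspace_def left_creation
      intro: left_algebra_closure_properties)

lemma subspace_ideal: "subspace (ideal_of_subspace M)"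
proof (rule subspaceI)
  have "scaleC_op 0 o\<^sub>L id_blinfun \<in> (left_algebra :: 'n fock_op set)"
    by (intro left_algebra_closure_properties)
  then have "(0 :: 'n fock_op) \<in> left_algebra"
    using scaleR_eq_scaleC_op[of 0 "id_blinfun :: 'n fock_op"] by simp
  then show "0 \<in> ideal_of_subspace M"
    by (simp add: ideal_of_subspace_def subspace_0[OF subspace])
next
  fix S T
  assume "S \<in> ideal_of_subspace M" "T \<in> ideal_of_subspace M"
  then show "S + T \<in> ideal_of_subspace M"
    by (auto simp: ideal_of_subspace_def blinfun.add_left
        intro: left_algebra_closure_properties subspace_add[OF subspace])
next
  fix r :: real and T
  assume "T \<in> ideal_of_subspace M"
  then show "r *\<^sub>R T \<in> ideal_of_subspace M"
    unfolding scaleR_eq_scaleC_op by (rule scaleC_ideal)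
qed

lemma subspace_mu: "subspace (subspace_of_ideal (ideal_of_subspace M))"
  unfolding subspace_of_ideal_def
  by (intro subspace_closure linear_subspace_image subspace_ideal linearI)
    (simp_all add: blinfun.add_left blinfun.scaleR_left)

lemma invariant_mu:
  assumes "\<And>J. J \<in> ideal_of_subspace M \<Longrightarrow> A o\<^sub>L J \<in> ideal_of_subspace M"
    and "x \<in> subspace_of_ideal (ideal_of_subspace M)"
  shows "blinfun_apply A x \<in> subspace_of_ideal (ideal_of_subspace M)"
proof -
  let ?S = "(\<lambda>J. blinfun_apply J \<xi>\<^sub>1) ` ideal_of_subspace M"
  have "blinfun_apply A ` ?S \<subseteq> ?S"
  proof clarify
    fix J
    assume "J \<in> ideal_of_subspace M"
    then show "blinfun_apply A (blinfun_apply J \<xi>\<^sub>1) \<in> ?S"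
      using assms(1) by (intro image_eqI[of _ _ "A o\<^sub>L J"]) auto
  qed
  then have "blinfun_apply A ` closure ?S \<subseteq> closure ?S"
    by (intro image_closure_subset order_trans[OF _ closure_subset])
      (auto intro!: continuous_intros)
  then show ?thesis
    using assms(2) unfolding subspace_of_ideal_def by blast
qed

lemma scaleC_mu:
  assumes "x \<in> subspace_of_ideal (ideal_of_subspace M)"
  shows "c *\<^sub>C x \<in> subspace_of_ideal (ideal_of_subspace M)"
  using invariant_mu[OF scaleC_ideal assms] by (simp add: scaleC_op.rep_eq)

lemma left_creation_mu:
  assumes "x \<in> subspace_of_ideal (ideal_of_subspace M)"
  shows "blinfun_apply (left_creation i) x \<in> subspace_of_ideal (ideal_of_subspace M)"
  using invariant_mu[OF left_creation_ideal assms] .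

end

lemma mu_subset:
  assumes "closed M"
  shows "subspace_of_ideal (ideal_of_subspace M) \<subseteq> M"
  unfolding subspace_of_ideal_def
  by (intro closure_minimal assms) (auto simp: ideal_of_subspace_def)

lemma left_invariant_range_right_algebra:
  assumes "R \<in> right_algebra"
  shows "left_invariant_subspace (range (blinfun_apply R))"
proof
  show "subspace (range (blinfun_apply R))"
    by (intro linear_subspace_image subspace_UNIV bounded_linear.linear blinfun.bounded_linear_right)
qed (auto simp: right_algebra_complex_linear[OF assms, symmetric]
    right_algebra_commutes_left_creation[OF assms, symmetric])

lemma closed_range_isometric:
  assumes "isometric R"
  shows "closed (range (blinfun_apply R))"
  using assms closed_UNIV blinfun.bounded_linear_right
  unfolding isometric_def
  by (intro complete_imp_closed complete_isometric_image[of 1]) (auto simp: complete_UNIV)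

section \<open>Cyclic flips\<close>

text \<open>A point lies in the closure of the image \<open>f ` I\<close> exactly when some proper filter on \<open>I\<close> pushes
  forward along \<open>f\<close> to a filter converging to it.  For one direction the filter generated by \<open>I\<close> and
  the preimages of the neighbourhoods of the point works.\<close>

lemma closure_image_iff_filter:
  fixes f :: "'a \<Rightarrow> 'b::t2_space"
  shows "p \<in> closure (f ` I) \<longleftrightarrow>
    (\<exists>F. F \<noteq> bot \<and> (\<forall>\<^sub>F J in F. J \<in> I) \<and> (f \<longlongrightarrow> p) F)"
proof
  assume p: "p \<in> closure (f ` I)"
  let ?F = "inf (filtercomap f (nhds p)) (principal I)"
  have "(f \<longlongrightarrow> p) ?F"
    by (rule filterlim_mono[OF filterlim_filtercomap order_refl inf_le1])
  moreover have "\<forall>\<^sub>F J in ?F. J \<in> I"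
    by (simp add: eventually_inf_principal)
  moreover have "?F \<noteq> bot"
  proof
    assume "?F = bot"
    then have "\<forall>\<^sub>F J in filtercomap f (nhds p). J \<notin> I"
      by (simp add: trivial_limit_def eventually_inf_principal)
    then obtain S where "open S" "p \<in> S" "\<And>J. f J \<in> S \<Longrightarrow> J \<notin> I"
      unfolding eventually_filtercomap_nhds by blast
    then have "S \<inter> f ` I = {}" by auto
    then show False
      using open_Int_closure_eq_empty[OF \<open>open S\<close>] p \<open>p \<in> S\<close> by blast
  qed
  ultimately show "\<exists>F. F \<noteq> bot \<and> (\<forall>\<^sub>F J in F. J \<in> I) \<and> (f \<longlongrightarrow> p) F"
    by blast
next
  assume "\<exists>F. F \<noteq> bot \<and> (\<forall>\<^sub>F J in F. J \<in> I) \<and> (f \<longlongrightarrow> p) F"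
  then obtain F where "F \<noteq> bot" "\<forall>\<^sub>F J in F. J \<in> I" and lim: "(f \<longlongrightarrow> p) F"
    by blast
  moreover from this have "\<forall>\<^sub>F J in F. f J \<in> closure (f ` I)"
    by (auto elim!: eventually_mono intro: closure_subset[THEN subsetD])
  ultimately show "p \<in> closure (f ` I)"
    by (intro Lim_in_closed_set[OF closed_closure _ _ lim])
qed

lemma cyclic_flip_iff_vacuum_image:
  assumes "R \<in> right_algebra" and "isometric R"
  shows "cyclic_flip R \<longleftrightarrow>
    blinfun_apply R \<xi>\<^sub>1 \<in> subspace_of_ideal (ideal_of_subspace (range (blinfun_apply R)))"
  using assms
  unfolding cyclic_flip_def subspace_of_ideal_def closure_image_iff_filter
  by (simp add: ideal_of_subspace_def)

text \<open>Since \<open>R \<xi>\<^sub>w = L\<^sub>w R \<xi>\<^sub>1\<close>, the vector \<open>R \<xi>\<^sub>1\<close> is cyclic in the range of \<open>R\<close> for the left creation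
  operators.\<close>

lemma range_subset_of_vacuum_image:
  assumes R: "R \<in> right_algebra"
    and N: "left_invariant_subspace N" "closed N"
    and vac: "blinfun_apply R \<xi>\<^sub>1 \<in> N"
  shows "range (blinfun_apply R) \<subseteq> N"
proof -
  interpret left_invariant_subspace N by (rule N)
  have "x \<in> blinfun_apply R -` N" for x
  proof (rule closed_subspace_contains_all)
    show "subspace (blinfun_apply R -` N)"
      by (intro linear_subspace_vimage subspace bounded_linear.linear blinfun.bounded_linear_right)
    show "closed (blinfun_apply R -` N)"
      by (intro closed_vimage N continuous_intros)
    show "c *\<^sub>C y \<in> blinfun_apply R -` N" if "y \<in> blinfun_apply R -` N" for c y
      using that by (simp add: right_algebra_complex_linear[OF R] scaleC)
    show "ell2_basis w \<in> blinfun_apply R -` N" for w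
      by (induction w)
        (simp_all add: vac left_creation right_algebra_commutes_left_creation[OF R]
          flip: left_creation_basis)
  qed
  then show ?thesis by auto
qed

theorem proposition3p11:
  fixes R :: "('n::finite) fock_op" and M :: "'n fock set"
  assumes "R \<in> right_algebra" and "isometric R" and "M = range (blinfun_apply R)"
  shows "cyclic_flip R \<longleftrightarrow> subspace_of_ideal (ideal_of_subspace M) = M"
proof -
  let ?N = "subspace_of_ideal (ideal_of_subspace M)"
  interpret left_invariant_subspace M
    unfolding assms(3) by (rule left_invariant_range_right_algebra[OF assms(1)])
  have flip: "cyclic_flip R \<longleftrightarrow> blinfun_apply R \<xi>\<^sub>1 \<in> ?N"
    using cyclic_flip_iff_vacuum_image[OF assms(1,2)] assms(3) by simp
  have "left_invariant_subspace ?N"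
    by unfold_locales (intro subspace_mu scaleC_mu left_creation_mu; assumption)+
  moreover have "closed ?N"
    by (simp add: subspace_of_ideal_def)
  ultimately have "M \<subseteq> ?N" if "cyclic_flip R"
    using range_subset_of_vacuum_image[OF assms(1)] that assms(3) flip by blast
  moreover have "?N \<subseteq> M"
    using mu_subset closed_range_isometric[OF assms(2)] assms(3) by blast
  moreover have "blinfun_apply R \<xi>\<^sub>1 \<in> M"
    using assms(3) by simp
  ultimately show ?thesis
    using flip by blast
qed

end
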